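(* The following sets are in bijection with one another: (a) $BUI^*$; (b) $L_2\setminus\{(0,1)\}$; (c) $\mathbb{I}\setminus\{[0,1]\}$; (d) $\mathbb{A}_2\setminus\{(0,0)\}$.
   Context: A basic uncertain information (BUI) granule is a pair $(x,c)\in[0,1]\times[0,1]$, where $x$ is the evaluation value and $c$ is the certainty degree of $x$. $BUI^*$ is the set of BUI granules $(x,c)$ with $c>0$. $L_2=\{(x_1,x_2)\in[0,1]^2: x_1\le x_2\}$. $\mathbb{I}$ is the set of all closed intervals $[a,b]\subseteq[0,1]$ (with $a\le b$). $\mathbb{A}_2=\{(a,b)\in[0,1]^2: a+b\le 1\}$. *)

theory Defs
  imports Complex_Main "HOL-Library.Equipollence"
begin

(* granules (x, c): evaluation value x, certainty degree c *)
definition BUI :: "(real \<times> real) set" where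
  "BUI = {0..1} \<times> {0..1}"

definition BUI_star :: "(real \<times> real) set" where
  "BUI_star = {(x, c). (x, c) \<in> BUI \<and> c > 0}"

definition L2 :: "(real \<times> real) set" where
  "L2 = {(x1, x2). x1 \<in> {0..1} \<and> x2 \<in> {0..1} \<and> x1 \<le> x2}"

definition closed_subintervals :: "real set set" where
  "closed_subintervals = {{a..b} | a b. a \<le> b \<and> {a..b} \<subseteq> {0..1}}"

definition A2 :: "(real \<times> real) set" where
  "A2 = {(a, b). a \<in> {0..1} \<and> b \<in> {0..1} \<and> a + b \<le> 1}"

end

theory Submission
  imports Defs
begin

text \<open>
  A granule \<open>(x, c)\<close> distributes a total mass \<open>c\<close> between evidence for, \<open>a = c x\<close>, and
  evidence against, \<open>b = c (1 - x)\<close>. The total \<open>a + b = c\<close> recovers the certainty, and the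
  proportion \<open>a / (a + b)\<close> recovers the evaluation exactly when the mass is positive; this is
  why certainty \<open>0\<close> is excluded on one side and \<open>(0, 0)\<close> on the other
  (\<open>bij_betw_BUI_star_A2\<close>).

  Measuring the evidence against from the right end of the unit interval turns \<open>(a, b)\<close> into
  the ordered pair \<open>(a, 1 - b)\<close>, and \<open>a + b \<le> 1\<close> into \<open>a \<le> 1 - b\<close>
  (\<open>bij_betw_A2_L2\<close>). An ordered pair is in turn determined by the closed interval that it
  bounds (\<open>bij_betw_L2_closed_subintervals\<close>). The same two formulas send the excluded point
  \<open>(0, 0)\<close>, which is no evidence at all, to \<open>(0, 1)\<close> and then to \<open>[0, 1]\<close>, the points that are
  excluded there.
  The remaining pairs of sets are handled by symmetry and transitivity of equipollence.
\<close>

lemma bij_betw_BUI_star_A2: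
  "bij_betw (\<lambda>(x, c). (c * x, c * (1 - x))) BUI_star (A2 - {(0, 0)})"
proof (rule bij_betw_byWitness[where f' = "\<lambda>(a, b). (a / (a + b), a + b)"])
  show "\<forall>p\<in>BUI_star. (\<lambda>(a, b). (a / (a + b), a + b)) ((\<lambda>(x, c). (c * x, c * (1 - x))) p) = p"
    by (auto simp: BUI_star_def algebra_simps)
  show "\<forall>p\<in>A2 - {(0, 0)}. (\<lambda>(x, c). (c * x, c * (1 - x))) ((\<lambda>(a, b). (a / (a + b), a + b)) p) = p"
  proof
    fix p :: "real \<times> real"
    assume "p \<in> A2 - {(0, 0)}"
    then obtain a b where "p = (a, b)" "a + b \<noteq> 0"
      by (cases p) (auto simp: A2_def)
    then show "(\<lambda>(x, c). (c * x, c * (1 - x))) ((\<lambda>(a, b). (a / (a + b), a + b)) p) = p"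
      by (simp add: right_diff_distrib)
  qed
  show "(\<lambda>(x, c). (c * x, c * (1 - x))) ` BUI_star \<subseteq> A2 - {(0, 0)}"
  proof clarify
    fix x c :: real
    assume "(x, c) \<in> BUI_star"
    then have *: "0 \<le> x" "x \<le> 1" "0 < c" "c \<le> 1"
      by (auto simp: BUI_star_def BUI_def)
    then have nonneg: "0 \<le> c * x" "0 \<le> c * (1 - x)"
      by simp_all
    have total: "c * x + c * (1 - x) = c"
      by (simp add: algebra_simps)
    have "c * x \<le> 1" "c * (1 - x) \<le> 1" "c * x + c * (1 - x) \<le> 1"
      using nonneg total * by linarith+
    moreover have "(c * x, c * (1 - x)) \<noteq> (0, 0)"
      using * by auto
    ultimately show "(c * x, c * (1 - x)) \<in> A2 - {(0, 0)}"
      using nonneg unfolding A2_def by auto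
  qed
  show "(\<lambda>(a, b). (a / (a + b), a + b)) ` (A2 - {(0, 0)}) \<subseteq> BUI_star"
  proof (rule image_subsetI)
    fix p :: "real \<times> real"
    assume "p \<in> A2 - {(0, 0)}"
    then obtain a b where "p = (a, b)" "0 \<le> a" "0 \<le> b" "a + b \<le> 1" "0 < a + b"
      by (cases p) (auto simp: A2_def)
    then show "(\<lambda>(a, b). (a / (a + b), a + b)) p \<in> BUI_star"
      by (simp add: BUI_star_def BUI_def)
  qed
qed

lemma bij_betw_A2_L2:
  "bij_betw (\<lambda>(a, b). (a, 1 - b)) (A2 - {(0, 0)}) (L2 - {(0, 1)})"
  by (rule bij_betw_byWitness[where f' = "\<lambda>(x1, x2). (x1, 1 - x2)"])
     (auto simp: A2_def L2_def)

text \<open>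
  Injectivity rests on the order in \<open>L2\<close>: the intervals are nonempty, and nonempty closed
  intervals determine their endpoints.
\<close>

lemma bij_betw_L2_closed_subintervals:
  "bij_betw (\<lambda>(x1, x2). {x1..x2}) (L2 - {(0, 1)}) (closed_subintervals - {{0..1}})"
  unfolding bij_betw_def
proof
  show "inj_on (\<lambda>(x1, x2). {x1..x2}) (L2 - {(0, 1)})"
    by (auto simp: inj_on_def L2_def Icc_eq_Icc)
  show "(\<lambda>(x1, x2). {x1..x2}) ` (L2 - {(0, 1)}) = closed_subintervals - {{0..1}}"
    by (fastforce simp: L2_def closed_subintervals_def Icc_eq_Icc image_iff)
qed

theorem proposition2:
  shows "BUI_star \<approx> L2 - {(0, 1)} \<and>
    BUI_star \<approx> closed_subintervals - {{0..1}} \<and>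
    BUI_star \<approx> A2 - {(0, 0)} \<and>
    L2 - {(0, 1)} \<approx> closed_subintervals - {{0..1}} \<and>
    L2 - {(0, 1)} \<approx> A2 - {(0, 0)} \<and>
    closed_subintervals - {{0..1}} \<approx> A2 - {(0, 0)}"
proof -
  have BA: "BUI_star \<approx> A2 - {(0, 0)}"
    using bij_betw_BUI_star_A2 unfolding eqpoll_def by blast
  have AL: "A2 - {(0, 0)} \<approx> L2 - {(0, 1)}"
    using bij_betw_A2_L2 unfolding eqpoll_def by blast
  have LI: "L2 - {(0, 1)} \<approx> closed_subintervals - {{0..1}}"
    using bij_betw_L2_closed_subintervals unfolding eqpoll_def by blast
  show ?thesis
    using BA AL LI by (meson eqpoll_sym eqpoll_trans)
qed

end
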